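(* Let $a,b,m,n$ be positive integers with $m-\varepsilon n=2ab$ and $\gcd(a,m)=\gcd(a,n)=1$, where $\varepsilon\in\{1,-1\}$. Then $$r_m(a)-\varepsilon r_n(a)=\left\lfloor \frac a2\right\rfloor b,$$ where for each positive integer $l$, $$r_l(a)=\left|\left\{r\in\mathbb Z:\ 0<r<\frac l2\ \text{and}\ \left\{\frac{ar}{l}\right\}>\frac12\right\}\right|.$$
   Context: $\lfloor\alpha\rfloor$ and $\{\alpha\}$ denote the integral part and the fractional part of a real number $\alpha$, respectively. *)

theory Defs
  imports Complex_Main
begin

definition r_count :: "int \<Rightarrow> int \<Rightarrow> nat" where
  "r_count l a = card {r :: int. 0 < r \<and> real_of_int r < real_of_int l / 2 \<and>
      frac (real_of_int (a * r) / real_of_int l) > 1 / 2}"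

end

theory Submission imports Defs begin

text \<open>
  An integer \<open>r\<close> is counted by \<open>r_l(a)\<close> iff \<open>k + 1/2 < a r / l < k + 1\<close> for some
  \<open>0 \<le> k < \<lfloor>a/2\<rfloor>\<close>, the bound \<open>r < l/2\<close> being automatic for these \<open>k\<close>. The interval
  belonging to \<open>k\<close> contributes \<open>\<lfloor>l (k + 1) / a\<rfloor> - \<lfloor>l (2 k + 1) / (2 a)\<rfloor>\<close>. Replacing \<open>l = n\<close> by
  \<open>l = \<epsilon> n + 2 a b\<close> adds \<open>2 b (k + 1) - b (2 k + 1) = b\<close> to this difference, up to the sign
  \<open>\<epsilon>\<close>; for \<open>\<epsilon> = -1\<close> the corrections in \<open>\<lfloor>- x\<rfloor> = - \<lfloor>x\<rfloor> - 1\<close> cancel, since by coprimality no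
  interval has an integral endpoint.
\<close>

text \<open>The fractional part of \<open>x / l\<close> is \<open>(x mod l) / l\<close>; this moves
  the counting condition from the reals to integer arithmetic.\<close>

lemma frac_of_int_div_gt_half_iff:
  fixes l x :: int
  assumes "l > 0"
  shows "frac (real_of_int x / real_of_int l) > 1 / 2 \<longleftrightarrow> l < 2 * (x mod l)"
proof -
  have "real_of_int x = real_of_int l * real_of_int (x div l) + real_of_int (x mod l)"
    by (metis mult_div_mod_eq of_int_add of_int_mult)
  then have "frac (real_of_int x / real_of_int l) = real_of_int (x mod l) / real_of_int l"
    unfolding frac_def floor_divide_of_int_eq using assms by (simp add: field_simps)
  then have "frac (real_of_int x / real_of_int l) > 1 / 2 \<longleftrightarrow>
      real_of_int l < real_of_int (2 * (x mod l))"
    using assms by (simp only:) (simp add: field_simps)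
  then show ?thesis
    by (simp only: of_int_less_iff)
qed

lemma int_le_div_iff:
  fixes r x c :: int
  assumes "c > 0"
  shows "r \<le> x div c \<longleftrightarrow> c * r \<le> x"
proof
  assume "r \<le> x div c"
  then have "c * r \<le> c * (x div c)"
    using assms by simp
  also have "\<dots> \<le> x"
    using assms pos_mod_sign[of c x] mult_div_mod_eq[of c x] by linarith
  finally show "c * r \<le> x" .
next
  assume "c * r \<le> x"
  then show "r \<le> x div c"
    using zdiv_mono1[of "c * r" x c] assms by simp
qed

text \<open>Coprimality forces \<open>a\<close> to divide \<open>c\<close>, which is too small. The
  uses are \<open>c = k + 1\<close> and \<open>c = 2 * k + 1\<close>, the factors in the interval
  endpoints.\<close>

lemma not_dvd_mult_of_coprime:
  fixes a l c :: int
  assumes "coprime a l" "0 < c" "c < a"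
  shows "\<not> a dvd l * c"
  using assms by (simp add: coprime_dvd_mult_right_iff zdvd_not_zless)

lemma uminus_div_of_not_dvd:
  fixes x c :: int
  assumes "c \<noteq> 0" "\<not> c dvd x"
  shows "- x div c = - (x div c) - 1"
  using assms by (simp add: zdiv_zminus1_eq_if dvd_eq_mod_eq_0)

text \<open>The interval containing \<open>r\<close> is indexed by the quotient
  \<open>k = a * r div l\<close>; the condition on the fractional part says that the remainder
  exceeds \<open>l / 2\<close>.\<close>

lemma r_count_set_eq:
  fixes l a :: int
  assumes "l > 0" "a > 0" "coprime a l"
  shows "{r :: int. 0 < r \<and> real_of_int r < real_of_int l / 2 \<and>
            frac (real_of_int (a * r) / real_of_int l) > 1 / 2} =
         (\<Union>k\<in>{0..<a div 2}. {l * (2 * k + 1) div (2 * a)<..l * (k + 1) div a})"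
    (is "?A = ?B")
proof -
  have mem_A: "r \<in> ?A \<longleftrightarrow> 0 < r \<and> 2 * r < l \<and> l < 2 * ((a * r) mod l)" for r
  proof -
    have "real_of_int r < real_of_int l / 2 \<longleftrightarrow> real_of_int (2 * r) < real_of_int l"
      by auto
    then show ?thesis
      using frac_of_int_div_gt_half_iff[OF assms(1), of "a * r"]
      by (simp only: of_int_less_iff mem_Collect_eq)
  qed
  have mem_int: "r \<in> {l * (2 * k + 1) div (2 * a)<..l * (k + 1) div a} \<longleftrightarrow>
      l * (2 * k + 1) < 2 * (a * r) \<and> a * r < l * (k + 1)" if k: "k \<in> {0..<a div 2}" for k r
  proof -
    \<comment> \<open>The half-open integer interval would contain an integral right endpoint, while
      the condition \<open>a * r < l * (k + 1)\<close> is strict; here \<open>k + 1 < a\<close>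
      excludes this case.\<close>
    have "\<not> a dvd l * (k + 1)"
      using k assms by (intro not_dvd_mult_of_coprime) auto
    then have "a * r \<noteq> l * (k + 1)"
      by (metis dvd_triv_left)
    then show ?thesis
      using int_le_div_iff[of a r "l * (k + 1)"] int_le_div_iff[of "2 * a" r "l * (2 * k + 1)"]
        assms(2) by (auto simp: not_le[symmetric] mult.assoc)
  qed
  show ?thesis
  proof (intro set_eqI iffI)
    fix r assume "r \<in> ?A"
    then have r: "0 < r" "2 * r < l" "l < 2 * ((a * r) mod l)"
      by (simp_all only: mem_A)
    define k where "k = (a * r) div l"
    have e: "a * r = l * k + (a * r) mod l"
      by (simp add: k_def)
    have "(a * r) mod l < l"
      using assms(1) by simp
    with e r(3) have b: "l * (2 * k + 1) < 2 * (a * r)" "a * r < l * (k + 1)"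
      by (auto simp: algebra_simps)
    have "k \<ge> 0"
      using assms r(1) by (simp add: k_def pos_imp_zdiv_nonneg_iff)
    \<comment> \<open>The bound \<open>2 * r < l\<close> is what limits \<open>k\<close>: both sides
      enclose \<open>2 * (a * r)\<close>.\<close>
    have "l * (2 * k + 1) < l * a"
      using b(1) mult_strict_left_mono[OF r(2) assms(2)] by (simp add: algebra_simps)
    then have "2 * k + 1 < a"
      using assms(1) by simp
    with \<open>k \<ge> 0\<close> have "k \<in> {0..<a div 2}"
      by simp
    with b mem_int show "r \<in> ?B"
      by blast
  next
    fix r assume "r \<in> ?B"
    then obtain k where k: "k \<in> {0..<a div 2}"
      and "r \<in> {l * (2 * k + 1) div (2 * a)<..l * (k + 1) div a}"
      by blast
    with mem_int have b: "l * (2 * k + 1) < 2 * (a * r)" "a * r < l * (k + 1)"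
      by blast+
    have "(a * r) div l = k"
      using b assms(1) by (intro int_div_pos_eq[of _ _ _ "a * r - l * k"]) (auto simp: algebra_simps)
    then have "(a * r) mod l = a * r - l * k"
      by (simp add: minus_mult_div_eq_mod[symmetric])
    then have 3: "l < 2 * ((a * r) mod l)"
      using b(1) by (simp add: algebra_simps)
    have "0 < l * (2 * k + 1)"
      using k assms(1) by simp
    with b(1) have "0 < a * r"
      by linarith
    then have 1: "0 < r"
      using assms(2) by (simp add: zero_less_mult_iff)
    \<comment> \<open>Conversely, \<open>k < a div 2\<close> means
      \<open>2 * (k + 1) \<le> a\<close>, whether \<open>a\<close> is even or odd.\<close>
    have "l * (2 * (k + 1)) \<le> l * a"
      using k assms(1) by (intro mult_left_mono) auto
    with b(2) have "a * (2 * r) < a * l"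
      by (simp add: algebra_simps)
    then have 2: "2 * r < l"
      using assms(2) by simp
    from 1 2 3 show "r \<in> ?A"
      by (simp only: mem_A)
  qed
qed

lemma r_count_eq_sum:
  fixes l a :: int
  assumes "l > 0" "a > 0" "coprime a l"
  shows "int (r_count l a) =
         (\<Sum>k\<in>{0..<a div 2}. l * (k + 1) div a - l * (2 * k + 1) div (2 * a))"
proof -
  let ?I = "\<lambda>k. {l * (2 * k + 1) div (2 * a)<..l * (k + 1) div a}"
  \<comment> \<open>Over the common denominator \<open>2 * a\<close>, right endpoints have even
    factors and left endpoints odd ones, so monotonicity of \<open>div\<close> orders them.\<close>
  have half: "l * (2 * k) div (2 * a) = l * k div a" for k
    by (simp add: mult.left_commute[of l 2])
  have "?I i \<inter> ?I j = {}" if "i < j" for i j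
  proof -
    have "l * (2 * (i + 1)) div (2 * a) \<le> l * (2 * j + 1) div (2 * a)"
      using that assms by (intro zdiv_mono1 mult_left_mono) auto
    then show ?thesis
      by (auto simp only: half greaterThanAtMost_iff)
  qed
  then have disjoint: "\<forall>i\<in>{0..<a div 2}. \<forall>j\<in>{0..<a div 2}. i \<noteq> j \<longrightarrow> ?I i \<inter> ?I j = {}"
    by (metis Int_commute linorder_neqE)
  have "int (r_count l a) = (\<Sum>k\<in>{0..<a div 2}. int (card (?I k)))"
    unfolding r_count_def r_count_set_eq[OF assms]
    using card_UN_disjoint[OF _ _ disjoint] by simp
  also have "\<dots> = (\<Sum>k\<in>{0..<a div 2}. l * (k + 1) div a - l * (2 * k + 1) div (2 * a))"
  proof (rule sum.cong)
    fix k
    \<comment> \<open>The endpoints are in order, so the truncation by \<open>nat\<close> in the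
      cardinality is harmless.\<close>
    have "l * (2 * k + 1) div (2 * a) \<le> l * (2 * (k + 1)) div (2 * a)"
      using assms by (intro zdiv_mono1 mult_left_mono) auto
    then show "int (card (?I k)) = l * (k + 1) div a - l * (2 * k + 1) div (2 * a)"
      by (simp only: half card_greaterThanAtMost_int int_nat_eq) simp
  qed simp
  finally show ?thesis .
qed

theorem theorem3:
  fixes a b m n \<epsilon> :: int
  assumes "a > 0" and "b > 0" and "m > 0" and "n > 0"
    and "\<epsilon> \<in> {1, -1}"
    and "m - \<epsilon> * n = 2 * a * b"
    and "gcd a m = 1" and "gcd a n = 1"
  shows "int (r_count m a) - \<epsilon> * int (r_count n a) = \<lfloor>real_of_int a / 2\<rfloor> * b"
proof -
  have cop: "coprime a m" "coprime a n"
    using assms(7,8) by (simp_all add: coprime_iff_gcd_eq_1)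
  let ?d = "\<lambda>l k. l * (k + 1) div a - l * (2 * k + 1) div (2 * a)"
  have "?d m k - \<epsilon> * ?d n k = b" if k: "k \<in> {0..<a div 2}" for k
  proof -
    have m: "m = \<epsilon> * n + 2 * a * b"
      using assms(6) by simp
    have "m * (k + 1) = \<epsilon> * (n * (k + 1)) + (2 * b * (k + 1)) * a"
      "m * (2 * k + 1) = \<epsilon> * (n * (2 * k + 1)) + (b * (2 * k + 1)) * (2 * a)"
      by (simp_all add: m algebra_simps)
    then have shift: "m * (k + 1) div a = \<epsilon> * (n * (k + 1)) div a + 2 * b * (k + 1)"
      "m * (2 * k + 1) div (2 * a) = \<epsilon> * (n * (2 * k + 1)) div (2 * a) + b * (2 * k + 1)"
      using assms(1) by (simp_all only: div_mult_self1)
    have "0 \<le> k" "k + 1 < a" "2 * k + 1 < a"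
      using k by auto
    \<comment> \<open>Since \<open>n\<close> may be even, \<open>2 * a\<close> need not be coprime
      to \<open>n\<close>; non-divisibility is shown for \<open>a\<close> first and then passes to
      the multiple \<open>2 * a\<close>.\<close>
    then have "\<not> a dvd n * (k + 1)" "\<not> a dvd n * (2 * k + 1)"
      using cop(2) by (simp_all add: not_dvd_mult_of_coprime)
    then have "\<not> a dvd n * (k + 1)" "\<not> 2 * a dvd n * (2 * k + 1)"
      by (auto dest: dvd_mult_right)
    then have neg: "(- (n * (k + 1))) div a = - (n * (k + 1) div a) - 1"
      "(- (n * (2 * k + 1))) div (2 * a) = - (n * (2 * k + 1) div (2 * a)) - 1"
      using assms(1) by (simp_all only: uminus_div_of_not_dvd not_False_eq_True)
    from assms(5) consider "\<epsilon> = 1" | "\<epsilon> = -1"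
      by auto
    then show ?thesis
    proof cases
      case 1
      show ?thesis
        unfolding shift 1 mult_1 by (simp only: right_diff_distrib distrib_left)
    next
      case 2
      show ?thesis
        unfolding shift 2 mult_minus1 neg by (simp only: right_diff_distrib distrib_left)
    qed
  qed
  then have "(\<Sum>k\<in>{0..<a div 2}. ?d m k - \<epsilon> * ?d n k) = (\<Sum>k\<in>{0..<a div 2}. b)"
    by (rule sum.cong[OF refl])
  moreover have "\<lfloor>real_of_int a / 2\<rfloor> = a div 2"
    using floor_divide_of_int_eq[of a 2] by simp
  \<comment> \<open>The constant sum has \<open>nat (a div 2)\<close> terms, and
    \<open>a div 2 \<ge> 0\<close> removes the \<open>nat\<close>.\<close>
  ultimately show ?thesis
    using r_count_eq_sum[OF assms(3,1) cop(1)] r_count_eq_sum[OF assms(4,1) cop(2)] assms(1)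
    by (simp only: sum_subtractf sum_distrib_left[symmetric]) (simp add: pos_imp_zdiv_nonneg_iff)
qed

end
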